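(* Let $J=\{j_1,\ldots,j_k\}\subset\mathbb{Z}^+$ with $1\le j_1<\cdots<j_k$, and let $n$ be an integer such that $J\subset\{1,\ldots,\lfloor n/2\rfloor\}$ and $\mathrm{Ci}_n(J)$ is connected. Define the divisor $D$ on $\mathrm{Ci}_n(J)$ by \[D(v_\alpha)=\begin{cases}\sum_{i=1}^k\max\{0,\ j_i-|j_k-\alpha|\}, & \alpha\in[1,2j_k-1],\\[0.5em] \sum_{i=1}^k\max\{0,\ j_i-|j_k-(n-\alpha+1)|\}, & \alpha\in[n-2j_k+1,n]\setminus[1,2j_k-1],\\[0.5em] 0,&\text{otherwise.}\end{cases}\] Then $D$ has positive rank.
   Context: The circulant graph $\mathrm{Ci}_n(J)$ (for $J\subset\{1,\ldots,\lfloor n/2\rfloor\}$) has vertices $v_1,\ldots,v_n$, with $v_i$ adjacent to $v_m$ if and only if $|i-m|\bmod n\in J$. A divisor on a graph $G$ is a function $D:V(G)\to\mathbb{Z}$; it is effective if $D(v)\ge0$ for all $v$. Firing a vertex $v$ moves one chip from $v$ along each edge incident to $v$; two divisors are equivalent if related by a sequence of firings. $D$ has positive rank if for every vertex $q$, the divisor $D-q$ (remove one chip from $q$) is equivalent to an effective divisor. *)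

theory Defs
  imports "Graph_Theory.Graph_Theory"
begin

text \<open>
  An undirected graph is a symmetric digraph: every undirected edge between two distinct vertices
  is a pair of opposite arcs, so the edges incident to a vertex correspond to its outgoing arcs.

  A divisor on a graph is a function from vertices to integers. Its values outside
  the vertex set are irrelevant: no firing changes them and effectiveness ignores them.
\<close>

type_synonym 'a divisor = "'a \<Rightarrow> int"

definition effective :: "('a, 'b) pre_digraph \<Rightarrow> 'a divisor \<Rightarrow> bool" where
  "effective G D \<longleftrightarrow> (\<forall>v \<in> verts G. D v \<ge> 0)"

definition fire :: "('a, 'b) pre_digraph \<Rightarrow> 'a \<Rightarrow> 'a divisor \<Rightarrow> 'a divisor" where
  "fire G v D = (\<lambda>w. D w - (if w = v then int (out_degree G v) else 0)
                         + int (card {e \<in> out_arcs G v. head G e = w}))"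

inductive fires_to :: "('a, 'b) pre_digraph \<Rightarrow> 'a divisor \<Rightarrow> 'a divisor \<Rightarrow> bool"
  for G :: "('a, 'b) pre_digraph" where
  "v \<in> verts G \<Longrightarrow> fires_to G D (fire G v D)"

text \<open>
  On a finite undirected graph this relation is symmetric, since firing every vertex exactly once
  leaves a divisor unchanged.
\<close>

definition equivalent_divisors :: "('a, 'b) pre_digraph \<Rightarrow> 'a divisor \<Rightarrow> 'a divisor \<Rightarrow> bool" where
  "equivalent_divisors G = (fires_to G)\<^sup>*\<^sup>*"

definition positive_rank :: "('a, 'b) pre_digraph \<Rightarrow> 'a divisor \<Rightarrow> bool" where
  "positive_rank G D \<longleftrightarrow>
     (\<forall>q \<in> verts G. \<exists>E. effective G E \<and> equivalent_divisors G (D(q := D q - 1)) E)"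

text \<open>
  The vertex \<open>v\<^sub>i\<close> is the integer \<open>i\<close>. Distances are taken around the cycle, so
  that \<open>v\<^sub>n\<close> and \<open>v\<^sub>1\<close> are at distance 1: two vertices are
  adjacent when one of the two residues of their difference modulo \<open>n\<close> lies in \<open>J\<close>. For even \<open>n\<close>
  and \<open>n div 2 \<in> J\<close>, opposite vertices are joined by a single edge.
\<close>

definition circulant :: "int \<Rightarrow> int set \<Rightarrow> (int, int \<times> int) pre_digraph" where
  "circulant n J = with_proj
     \<lparr> pverts = {1..n},
       parcs = {(i, m). i \<in> {1..n} \<and> m \<in> {1..n} \<and> ((i - m) mod n \<in> J \<or> (m - i) mod n \<in> J)} \<rparr>"

text \<open>
  The sequence \<open>j\<^sub>1 < \<dots> < j\<^sub>k\<close> is given by the values of \<open>j\<close> on \<open>{1..k}\<close>.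
\<close>

definition circulant_divisor :: "int \<Rightarrow> nat \<Rightarrow> (nat \<Rightarrow> int) \<Rightarrow> int divisor" where
  "circulant_divisor n k j = (\<lambda>\<alpha>.
     if \<alpha> \<in> {1..2 * j k - 1} then
       (\<Sum>i = 1..k. max 0 (j i - \<bar>j k - \<alpha>\<bar>))
     else if \<alpha> \<in> {n - 2 * j k + 1..n} then
       (\<Sum>i = 1..k. max 0 (j i - \<bar>j k - (n - \<alpha> + 1)\<bar>))
     else 0)"

end

theory Submission
  imports Defs
begin

text \<open>
  Let \<open>T\<^sub>c\<close> be the sum over \<open>j \<in> J\<close> of the tents of height \<open>j\<close> around \<open>c\<close>, taken modulo \<open>n\<close>. The
  second difference with step \<open>j\<close> is the second difference with step \<open>1\<close> weighted by a tent of
  height \<open>j\<close>. So if no \<open>j \<in> J\<close> equals \<open>n / 2\<close>, firing \<open>c\<close> adds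
  \<open>T\<^bsub>c-1\<^esub> - 2 T\<^sub>c + T\<^bsub>c+1\<^esub>\<close>; by telescoping, firing \<open>a, \<dots>, b\<close> turns \<open>T\<^sub>a + T\<^sub>b\<close> into
  \<open>T\<^bsub>a-1\<^esub> + T\<^bsub>b+1\<^esub>\<close>. If the two tents of \<open>D\<close> do not overlap, then \<open>D\<close> is the sum of
  \<open>T\<^sub>a\<close> and \<open>T\<^sub>b\<close> with \<open>a = j\<^sub>k\<close> and \<open>a + b = n + 1\<close>, hence equivalent to
  \<open>T\<^sub>q + T\<^bsub>n+1-q\<^esub>\<close> for every vertex \<open>q\<close>. If they overlap, in particular if \<open>j\<^sub>k = n / 2\<close>, then
  every vertex carries a chip of \<open>D\<close>.
\<close>

section \<open>Summation by parts against a tent\<close>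

lemma sum_second_difference:
  fixes g :: "int \<Rightarrow> int"
  shows "(\<Sum>i = - int m..int m. g (i + 1) + g (i - 1) - 2 * g i)
    = g (int m + 1) - g (int m) + g (- 1 - int m) - g (- int m)"
proof (induction m)
  case (Suc m)
  have "{- int (Suc m)..int (Suc m)}
      = insert (- 1 - int m) (insert (int m + 1) {- int m..int m})"
    by auto
  moreover have "- int m - 1 = - 1 - int m"
    by simp
  ultimately show ?case
    using Suc by (simp add: algebra_simps)
qed simp

text \<open>Raising the height from \<open>m\<close> to \<open>m + 1\<close> adds the unweighted sum
  of second differences over \<open>{- int m..int m}\<close>, which telescopes to boundary
  values.\<close>

lemma sum_tent_second_difference_nat:
  fixes g :: "int \<Rightarrow> int"
  shows "(\<Sum>i\<in>{- int m<..<int m}. (int m - \<bar>i\<bar>) * (g (i + 1) + g (i - 1) - 2 * g i))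
    = g (int m) + g (- int m) - 2 * g 0"
proof (induction m)
  case (Suc m)
  let ?h = "\<lambda>i. g (i + 1) + g (i - 1) - 2 * g i"
  have S: "{- int (Suc m)<..<int (Suc m)} = {- int m..int m}"
    by auto
  have "(\<Sum>i\<in>{- int m..int m}. (int (Suc m) - \<bar>i\<bar>) * ?h i)
      = (\<Sum>i\<in>{- int m..int m}. (int m - \<bar>i\<bar>) * ?h i) + (\<Sum>i\<in>{- int m..int m}. ?h i)"
    by (subst sum.distrib [symmetric]) (simp add: algebra_simps)
  also have "(\<Sum>i\<in>{- int m..int m}. (int m - \<bar>i\<bar>) * ?h i)
      = (\<Sum>i\<in>{- int m<..<int m}. (int m - \<bar>i\<bar>) * ?h i)"
    by (rule sum.mono_neutral_right) auto
  finally show ?case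
    unfolding S Suc.IH sum_second_difference by (simp add: algebra_simps)
qed simp

lemma sum_tent_second_difference:
  fixes g :: "int \<Rightarrow> int"
  assumes "0 \<le> j"
  shows "(\<Sum>i\<in>{- j<..<j}. (j - \<bar>i\<bar>) * (g (i + 1) + g (i - 1) - 2 * g i))
    = g j + g (- j) - 2 * g 0"
  using sum_tent_second_difference_nat [of "nat j" g] assms by simp

section \<open>Tents on the cycle\<close>

text \<open>Weighted residue indicators replace a maximum: periodicity in \<open>c\<close> is built
  in, and moving \<open>c\<close> by one only shifts \<open>i\<close>, as summation by parts
  requires.\<close>

definition cyclic_tent :: "int \<Rightarrow> int set \<Rightarrow> int \<Rightarrow> int \<Rightarrow> int" where
  "cyclic_tent n J c x =
     (\<Sum>j\<in>J. \<Sum>i\<in>{- j<..<j}. (j - \<bar>i\<bar>) * of_bool (n dvd x + i - c))"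

lemma cyclic_tent_nonneg: "0 \<le> cyclic_tent n J c x"
  unfolding cyclic_tent_def by (intro sum_nonneg) auto

lemma cyclic_tent_center_pos:
  assumes "finite J" "j \<in> J" "0 < j"
  shows "0 < cyclic_tent n J c c"
  unfolding cyclic_tent_def
proof (rule sum_pos2 [OF assms(1,2)])
  show "0 < (\<Sum>i\<in>{- j<..<j}. (j - \<bar>i\<bar>) * of_bool (n dvd c + i - c))"
    using assms by (intro sum_pos2 [of _ 0]) auto
qed (auto intro!: sum_nonneg)

lemma cyclic_tent_shift: "cyclic_tent n J (c + n) x = cyclic_tent n J c x"
proof -
  have "n dvd x + i - (c + n) \<longleftrightarrow> n dvd x + i - c" for i
    using dvd_add_right_iff [of n "- n" "x + i - c"] by (simp add: algebra_simps)
  then show ?thesis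
    unfolding cyclic_tent_def by simp
qed

text \<open>The bound keeps \<open>x + i - c\<close> strictly between \<open>- n\<close> and
  \<open>n\<close>, so 0 is the only multiple of \<open>n\<close> that can occur. At most the index
  \<open>i = c - x\<close> survives; the maximum with 0 covers the case where it is out of
  range.\<close>

lemma cyclic_tent_no_wrap:
  assumes "\<And>j. j \<in> J \<Longrightarrow> \<bar>x - c\<bar> + j \<le> n"
  shows "cyclic_tent n J c x = (\<Sum>j\<in>J. max 0 (j - \<bar>c - x\<bar>))"
  unfolding cyclic_tent_def
proof (rule sum.cong [OF refl])
  fix j assume j: "j \<in> J"
  have "n dvd x + i - c \<longleftrightarrow> i = c - x" if "i \<in> {- j<..<j}" for i
  proof
    assume "n dvd x + i - c"
    moreover have "\<bar>x + i - c\<bar> < n"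
      using assms [OF j] that by auto
    ultimately show "i = c - x"
      using zdvd_not_zless [of "\<bar>x + i - c\<bar>" n] by force
  qed simp
  then have "(\<Sum>i\<in>{- j<..<j}. (j - \<bar>i\<bar>) * of_bool (n dvd x + i - c))
      = (\<Sum>i\<in>{- j<..<j}. if i = c - x then j - \<bar>i\<bar> else 0)"
    by (intro sum.cong) auto
  also have "\<dots> = max 0 (j - \<bar>c - x\<bar>)"
    by (subst sum.delta) auto
  finally show "(\<Sum>i\<in>{- j<..<j}. (j - \<bar>i\<bar>) * of_bool (n dvd x + i - c))
      = max 0 (j - \<bar>c - x\<bar>)" .
qed

text \<open>Moving the centre shifts the indicator, so \<open>sum_tent_second_difference\<close>
  applies for each \<open>j\<close>. If \<open>0 < j\<close> and \<open>2 * j < n\<close> on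
  \<open>J\<close>, the right-hand side is the effect at vertex \<open>x\<close> of firing vertex
  \<open>c\<close>.\<close>

lemma cyclic_tent_second_difference:
  assumes "\<And>j. j \<in> J \<Longrightarrow> 0 \<le> j"
  shows "cyclic_tent n J (c - 1) x + cyclic_tent n J (c + 1) x - 2 * cyclic_tent n J c x
    = (\<Sum>j\<in>J. of_bool (n dvd x + j - c) + of_bool (n dvd x - j - c) - 2 * of_bool (n dvd x - c))"
proof -
  let ?g = "\<lambda>i. of_bool (n dvd x + i - c) :: int"
  have "cyclic_tent n J (c - 1) x + cyclic_tent n J (c + 1) x - 2 * cyclic_tent n J c x
      = (\<Sum>j\<in>J. \<Sum>i\<in>{- j<..<j}. (j - \<bar>i\<bar>) * (?g (i + 1) + ?g (i - 1) - 2 * ?g i))"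
    unfolding cyclic_tent_def sum_distrib_left sum.distrib [symmetric] sum_subtractf [symmetric]
    by (intro sum.cong refl) (simp add: algebra_simps)
  also have "\<dots> = (\<Sum>j\<in>J. ?g j + ?g (- j) - 2 * ?g 0)"
    using assms by (intro sum.cong refl sum_tent_second_difference) auto
  finally show ?thesis
    by simp
qed

section \<open>The effect of a single firing on a circulant graph\<close>

lemma dvd_diff_iff_eq_of_mem_cycle:
  fixes n :: int
  assumes "x \<in> {1..n}" "y \<in> {1..n}"
  shows "n dvd x - y \<longleftrightarrow> x = y"
proof
  assume "n dvd x - y"
  then show "x = y"
    using zdvd_not_zless [of "\<bar>x - y\<bar>" n] assms by force
qed simp

lemma sum_of_bool_dvd_cycle:
  fixes n :: int
  assumes "0 < n"
  shows "(\<Sum>x = 1..n. of_bool (n dvd x + d)) = (1 :: int)"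
proof -
  \<comment> \<open>The representative of \<open>- d\<close> modulo \<open>n\<close>; the shift by
    one moves the remainder from \<open>{0..n - 1}\<close> to \<open>{1..n}\<close>.\<close>
  define y where "y = (- d - 1) mod n + 1"
  have y: "y \<in> {1..n}"
    using pos_mod_bound [OF assms, of "- d - 1"] pos_mod_sign [OF assms, of "- d - 1"]
    unfolding y_def atLeastAtMost_iff by linarith
  have dy: "n dvd y + d"
  proof -
    have "- (y + d) = (- d - 1) - (- d - 1) mod n"
      by (simp add: y_def)
    then show ?thesis
      using dvd_minus_mod [of n "- d - 1"] by (metis dvd_minus_iff)
  qed
  have "n dvd x + d \<longleftrightarrow> x = y" if "x \<in> {1..n}" for x
    using dvd_diff_iff_eq_of_mem_cycle [OF that y] dvd_add_left_iff [OF dy, of "x - y"] by simp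
  then have "(\<Sum>x = 1..n. of_bool (n dvd x + d)) = (\<Sum>x = 1..n. if x = y then 1 else 0 :: int)"
    by (intro sum.cong) auto
  then show ?thesis
    using y by simp
qed

text \<open>Each \<open>j\<close> yields the neighbours \<open>c - j\<close> and
  \<open>c + j\<close> modulo \<open>n\<close>. Nothing is counted twice: the two residues of the
  difference sum to a multiple of \<open>n\<close>, whereas two elements of \<open>J\<close> have a
  sum strictly between 0 and \<open>n\<close>.\<close>

lemma of_bool_circulant_adjacent:
  fixes n :: int
  assumes "finite J" "\<forall>j\<in>J. 0 < j \<and> 2 * j < n"
  shows "of_bool ((c - x) mod n \<in> J \<or> (x - c) mod n \<in> J)
    = (\<Sum>j\<in>J. of_bool (n dvd x + j - c) + of_bool (n dvd x - j - c) :: int)"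
proof -
  have mod_eq: "n dvd y - j \<longleftrightarrow> y mod n = j" if "j \<in> J" for y j
    using bspec [OF assms(2) that] mod_eq_dvd_iff [of y n j] by simp
  have "n dvd x + j - c \<longleftrightarrow> (c - x) mod n = j" if "j \<in> J" for j
    using mod_eq [OF that, of "c - x"] dvd_minus_iff [of n "x + j - c"]
    by (simp add: algebra_simps)
  moreover have "n dvd x - j - c \<longleftrightarrow> (x - c) mod n = j" if "j \<in> J" for j
    using mod_eq [OF that, of "x - c"] by (simp add: algebra_simps)
  ultimately have "(\<Sum>j\<in>J. of_bool (n dvd x + j - c) + of_bool (n dvd x - j - c) :: int)
      = (\<Sum>j\<in>J. if (c - x) mod n = j then 1 else 0) + (\<Sum>j\<in>J. if (x - c) mod n = j then 1 else 0)"
    unfolding sum.distrib [symmetric] by (intro sum.cong) auto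
  also have "\<dots> = of_bool ((c - x) mod n \<in> J) + of_bool ((x - c) mod n \<in> J)"
    using assms(1) by simp
  also have "\<dots> = of_bool ((c - x) mod n \<in> J \<or> (x - c) mod n \<in> J)"
  proof -
    have False if J: "(c - x) mod n \<in> J" "(x - c) mod n \<in> J"
    proof -
      have "((c - x) mod n + (x - c) mod n) mod n = 0"
        by (simp add: mod_add_eq)
      moreover have "((c - x) mod n + (x - c) mod n) mod n = (c - x) mod n + (x - c) mod n"
        using bspec [OF assms(2) J(1)] bspec [OF assms(2) J(2)] by (intro mod_pos_pos_trivial) auto
      ultimately show False
        using bspec [OF assms(2) J(1)] bspec [OF assms(2) J(2)] by linarith
    qed
    then show ?thesis
      by auto
  qed
  finally show ?thesis
    by simp
qed

lemma verts_circulant [simp]: "verts (circulant n J) = {1..n}"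
  by (simp add: circulant_def)

lemma out_arcs_circulant:
  assumes "c \<in> {1..n}"
  shows "out_arcs (circulant n J) c
    = Pair c ` {x \<in> {1..n}. (c - x) mod n \<in> J \<or> (x - c) mod n \<in> J}"
  using assms by (auto simp: out_arcs_def circulant_def)

lemma head_circulant [simp]: "head (circulant n J) = snd"
  by (simp add: circulant_def)

lemma out_degree_circulant:
  assumes "finite J" "\<forall>j\<in>J. 0 < j \<and> 2 * j < n" "c \<in> {1..n}"
  shows "int (out_degree (circulant n J) c) = 2 * int (card J)"
proof -
  have "int (out_degree (circulant n J) c)
      = (\<Sum>x = 1..n. of_bool ((c - x) mod n \<in> J \<or> (x - c) mod n \<in> J))"
    unfolding out_degree_def out_arcs_circulant [OF assms(3)]
    by (subst card_image)
      (auto simp: inj_on_def sum_of_bool_eq Collect_conj_eq simp del: of_bool_or_iff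
        intro!: arg_cong [where f = card])
  also have "\<dots> = (\<Sum>x = 1..n. \<Sum>j\<in>J.
      of_bool (n dvd x + (j - c)) + of_bool (n dvd x + (- j - c)))"
    unfolding of_bool_circulant_adjacent [OF assms(1,2)] by (simp add: algebra_simps)
  also have "\<dots> = (\<Sum>j\<in>J. (\<Sum>x = 1..n. of_bool (n dvd x + (j - c)))
      + (\<Sum>x = 1..n. of_bool (n dvd x + (- j - c))))"
    by (subst sum.swap) (simp only: sum.distrib)
  also have "\<dots> = 2 * int (card J)"
    using assms(3) by (simp add: sum_of_bool_dvd_cycle del: sum_of_bool_eq)
  finally show ?thesis .
qed

text \<open>The loss and the arrivals at \<open>x\<close>, both written as sums over
  \<open>J\<close>, form the right-hand side of
  \<open>cyclic_tent_second_difference\<close>.\<close>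

lemma fire_circulant:
  assumes "finite J" "\<forall>j\<in>J. 0 < j \<and> 2 * j < n" "c \<in> {1..n}" "x \<in> {1..n}"
  shows "fire (circulant n J) c D x
    = D x + cyclic_tent n J (c - 1) x + cyclic_tent n J (c + 1) x - 2 * cyclic_tent n J c x"
proof -
  have "{e \<in> out_arcs (circulant n J) c. head (circulant n J) e = x}
      = (if (c - x) mod n \<in> J \<or> (x - c) mod n \<in> J then {(c, x)} else {})"
    using assms(4) unfolding out_arcs_circulant [OF assms(3)] by auto
  then have "int (card {e \<in> out_arcs (circulant n J) c. head (circulant n J) e = x})
      = of_bool ((c - x) mod n \<in> J \<or> (x - c) mod n \<in> J)"
    by simp
  moreover have "(if x = c then int (out_degree (circulant n J) c) else 0)
      = (\<Sum>j\<in>J. 2 * of_bool (n dvd x - c))"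
    using out_degree_circulant [OF assms(1-3)]
      dvd_diff_iff_eq_of_mem_cycle [OF assms(4,3)] by auto
  moreover have "cyclic_tent n J (c - 1) x + cyclic_tent n J (c + 1) x - 2 * cyclic_tent n J c x
    = (\<Sum>j\<in>J. of_bool (n dvd x + j - c) + of_bool (n dvd x - j - c) - 2 * of_bool (n dvd x - c))"
    using assms(2) by (intro cyclic_tent_second_difference) force
  ultimately show ?thesis
    unfolding fire_def of_bool_circulant_adjacent [OF assms(1,2)] sum_subtractf by linarith
qed

section \<open>Equivalence and the motion of a mirror pair of tents\<close>

lemma equivalent_divisors_refl: "equivalent_divisors G D D"
  by (simp add: equivalent_divisors_def)

lemma equivalent_divisors_trans:
  "equivalent_divisors G D E \<Longrightarrow> equivalent_divisors G E F \<Longrightarrow> equivalent_divisors G D F"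
  unfolding equivalent_divisors_def by (rule rtranclp_trans)

lemma equivalent_divisors_fire: "v \<in> verts G \<Longrightarrow> equivalent_divisors G D (fire G v D)"
  unfolding equivalent_divisors_def by (intro r_into_rtranclp fires_to.intros)

text \<open>Each fired vertex adds a second difference in the centre; the sum telescopes and only
  first differences at the two ends remain.\<close>

lemma fire_interval_circulant:
  assumes "finite J" "\<forall>j\<in>J. 0 < j \<and> 2 * j < n" "1 \<le> a" "a + int m \<le> n"
  obtains E where "equivalent_divisors (circulant n J) D E"
    and "\<And>x. x \<in> {1..n} \<Longrightarrow> E x = D x + cyclic_tent n J (a - 1) x - cyclic_tent n J a x
      - cyclic_tent n J (a + int m) x + cyclic_tent n J (a + int m + 1) x"
proof -
  have "\<exists>E. equivalent_divisors (circulant n J) D E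
    \<and> (\<forall>x \<in> {1..n}. E x = D x + cyclic_tent n J (a - 1) x - cyclic_tent n J a x
      - cyclic_tent n J (a + int m) x + cyclic_tent n J (a + int m + 1) x)"
    using assms(4)
  proof (induction m)
    case 0
    then show ?case
      using assms(3) fire_circulant [OF assms(1,2), where c = a]
      by (intro exI [of _ "fire (circulant n J) a D"]) (auto intro: equivalent_divisors_fire)
  next
    case (Suc m)
    then obtain E where E: "equivalent_divisors (circulant n J) D E"
      "\<forall>x \<in> {1..n}. E x = D x + cyclic_tent n J (a - 1) x - cyclic_tent n J a x
        - cyclic_tent n J (a + int m) x + cyclic_tent n J (a + int m + 1) x"
      by auto
    let ?c = "a + int (Suc m)"
    have c: "?c \<in> {1..n}"
      using Suc.prems assms(3) by auto
    have "equivalent_divisors (circulant n J) D (fire (circulant n J) ?c E)"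
      using c by (intro equivalent_divisors_trans [OF E(1)] equivalent_divisors_fire)
        (simp only: verts_circulant)
    moreover have "\<forall>x \<in> {1..n}. fire (circulant n J) ?c E x
        = D x + cyclic_tent n J (a - 1) x - cyclic_tent n J a x
          - cyclic_tent n J ?c x + cyclic_tent n J (?c + 1) x"
    proof -
      obtain b where b: "a + int (Suc m) = b" "a + int m = b - 1"
        by (rule that [OF refl]) simp
      show ?thesis
        using E(2) fire_circulant [OF assms(1,2) c] unfolding b by simp
    qed
    ultimately show ?case
      by blast
  qed
  then show thesis
    using that by blast
qed

text \<open>Each unit step fires all vertices from one centre to its mirror image. \<open>D\<close>
  is arbitrary: neither it nor the intermediate divisors have to be effective.\<close>

lemma tents_move_outward:
  assumes "finite J" "\<forall>j\<in>J. 0 < j \<and> 2 * j < n"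
    and "1 \<le> a - int m" "2 * a \<le> n + 1"
  obtains E where "equivalent_divisors (circulant n J) D E"
    and "\<And>x. x \<in> {1..n} \<Longrightarrow> E x = D x - cyclic_tent n J a x - cyclic_tent n J (n + 1 - a) x
      + cyclic_tent n J (a - int m) x + cyclic_tent n J (n + 1 - (a - int m)) x"
proof -
  have "\<exists>E. equivalent_divisors (circulant n J) D E \<and> (\<forall>x \<in> {1..n}.
      E x = D x - cyclic_tent n J a x - cyclic_tent n J (n + 1 - a) x
      + cyclic_tent n J (a - int m) x + cyclic_tent n J (n + 1 - (a - int m)) x)"
    using assms(3)
  proof (induction m)
    case 0
    then show ?case
      by (auto intro: equivalent_divisors_refl)
  next
    case (Suc m)
    then obtain E where E: "equivalent_divisors (circulant n J) D E"
      "\<forall>x \<in> {1..n}. E x = D x - cyclic_tent n J a x - cyclic_tent n J (n + 1 - a) x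
      + cyclic_tent n J (a - int m) x + cyclic_tent n J (n + 1 - (a - int m)) x"
      by auto
    let ?b = "a - int m"
    let ?m = "nat (n + 1 - 2 * ?b)"
    have m: "?b + int ?m = n + 1 - ?b" "1 \<le> ?b" "n + 1 - ?b \<le> n"
      using Suc.prems assms(4) by auto
    obtain F where F: "equivalent_divisors (circulant n J) E F"
      "\<And>x. x \<in> {1..n} \<Longrightarrow> F x = E x + cyclic_tent n J (?b - 1) x - cyclic_tent n J ?b x
      - cyclic_tent n J (n + 1 - ?b) x + cyclic_tent n J (n + 1 - ?b + 1) x"
      using fire_interval_circulant [OF assms(1,2), where a = ?b and m = ?m and D = E] m by metis
    have "equivalent_divisors (circulant n J) D F"
      using E(1) F(1) by (rule equivalent_divisors_trans)
    moreover have "F x = D x - cyclic_tent n J a x - cyclic_tent n J (n + 1 - a) x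
      + cyclic_tent n J (a - int (Suc m)) x + cyclic_tent n J (n + 1 - (a - int (Suc m))) x"
      if x: "x \<in> {1..n}" for x
    proof -
      obtain b where b: "a - int (Suc m) = b" "a - int m = b + 1"
        by (rule that [OF refl]) simp
      show ?thesis
        using bspec [OF E(2) x] F(2) [OF x] unfolding b by (simp add: algebra_simps)
    qed
    ultimately show ?case
      by blast
  qed
  then show thesis
    using that by blast
qed

text \<open>Moving the tents towards each other means firing all vertices that are not strictly between them.\<close>

lemma tents_move_inward:
  assumes "finite J" "\<forall>j\<in>J. 0 < j \<and> 2 * j < n"
    and "1 \<le> a" "2 * (a + int m) \<le> n + 1"
  obtains E where "equivalent_divisors (circulant n J) D E"
    and "\<And>x. x \<in> {1..n} \<Longrightarrow> E x = D x - cyclic_tent n J a x - cyclic_tent n J (n + 1 - a) x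
      + cyclic_tent n J (a + int m) x + cyclic_tent n J (n + 1 - (a + int m)) x"
proof -
  have "\<exists>E. equivalent_divisors (circulant n J) D E \<and> (\<forall>x \<in> {1..n}.
      E x = D x - cyclic_tent n J a x - cyclic_tent n J (n + 1 - a) x
      + cyclic_tent n J (a + int m) x + cyclic_tent n J (n + 1 - (a + int m)) x)"
    using assms(4)
  proof (induction m)
    case 0
    then show ?case
      by (auto intro: equivalent_divisors_refl)
  next
    case (Suc m)
    then obtain E where E: "equivalent_divisors (circulant n J) D E"
      "\<forall>x \<in> {1..n}. E x = D x - cyclic_tent n J a x - cyclic_tent n J (n + 1 - a) x
      + cyclic_tent n J (a + int m) x + cyclic_tent n J (n + 1 - (a + int m)) x"
      by auto
    let ?b = "a + int m"
    \<comment> \<open>The arcs \<open>{1..?b}\<close> and \<open>{n + 1 - ?b..n}\<close> have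
      \<open>?m + 1\<close> vertices each; around the cycle they join into one.\<close>
    let ?m = "nat (?b - 1)"
    have m: "1 + int ?m = ?b" "(n + 1 - ?b) + int ?m = n" "?b \<le> n" "1 \<le> n + 1 - ?b"
      using Suc.prems assms(3) by auto
    obtain F where F: "equivalent_divisors (circulant n J) E F"
      "\<And>x. x \<in> {1..n} \<Longrightarrow> F x = E x + cyclic_tent n J (1 - 1) x - cyclic_tent n J 1 x
      - cyclic_tent n J ?b x + cyclic_tent n J (?b + 1) x"
      using fire_interval_circulant [OF assms(1,2), where a = 1 and m = ?m and D = E] m
      by (metis order_refl)
    obtain H where H: "equivalent_divisors (circulant n J) F H"
      "\<And>x. x \<in> {1..n} \<Longrightarrow> H x = F x + cyclic_tent n J (n + 1 - ?b - 1) x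
        - cyclic_tent n J (n + 1 - ?b) x - cyclic_tent n J n x + cyclic_tent n J (n + 1) x"
      using fire_interval_circulant [OF assms(1,2), where a = "n + 1 - ?b" and m = ?m and D = F] m
      by (metis order_refl)
    have "equivalent_divisors (circulant n J) D H"
      using E(1) F(1) H(1) by (blast intro: equivalent_divisors_trans)
    moreover have "H x = D x - cyclic_tent n J a x - cyclic_tent n J (n + 1 - a) x
      + cyclic_tent n J (a + int (Suc m)) x + cyclic_tent n J (n + 1 - (a + int (Suc m))) x"
      if x: "x \<in> {1..n}" for x
    proof -
      obtain b where b: "a + int (Suc m) = b" "a + int m = b - 1"
        by (rule that [OF refl]) simp
      \<comment> \<open>Where the arcs meet, the boundary terms at 0 and 1 cancel those at
        \<open>n\<close> and \<open>n + 1\<close> by periodicity.\<close>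
      have "cyclic_tent n J n x = cyclic_tent n J 0 x"
        "cyclic_tent n J (n + 1) x = cyclic_tent n J 1 x"
        using cyclic_tent_shift [of n J 0 x] cyclic_tent_shift [of n J 1 x]
        by (simp_all add: add.commute)
      then show ?thesis
        using bspec [OF E(2) x] F(2) [OF x] H(2) [OF x] unfolding b by (simp add: algebra_simps)
    qed
    ultimately show ?case
      by blast
  qed
  then show thesis
    using that by blast
qed

lemma tents_move:
  assumes "finite J" "\<forall>j\<in>J. 0 < j \<and> 2 * j < n"
    and "1 \<le> a" "2 * a \<le> n + 1" "1 \<le> b" "2 * b \<le> n + 1"
  obtains E where "equivalent_divisors (circulant n J) D E"
    and "\<And>x. x \<in> {1..n} \<Longrightarrow> E x = D x - cyclic_tent n J a x - cyclic_tent n J (n + 1 - a) x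
      + cyclic_tent n J b x + cyclic_tent n J (n + 1 - b) x"
proof (cases "b \<le> a")
  case True
  then have "a - int (nat (a - b)) = b"
    by simp
  then show thesis
    using tents_move_outward [OF assms(1,2), where a = a and m = "nat (a - b)" and D = D] assms(4,5) that
    by metis
next
  case False
  then have "a + int (nat (b - a)) = b"
    by simp
  then show thesis
    using tents_move_inward [OF assms(1,2), where a = a and m = "nat (b - a)" and D = D] assms(3,6) that
    by metis
qed

section \<open>Positive rank\<close>

text \<open>The pair is moved until one tent is centred at \<open>q\<close>, where its positive
  height pays for the removed chip; elsewhere only nonnegative tents are added.\<close>

lemma positive_rank_two_tents:
  assumes "finite J" "J \<noteq> {}" "\<forall>j\<in>J. 0 < j \<and> 2 * j < n"
    and "1 \<le> a" "2 * a \<le> n + 1"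
    and D: "\<And>x. x \<in> {1..n} \<Longrightarrow> D x = cyclic_tent n J a x + cyclic_tent n J (n + 1 - a) x"
  shows "positive_rank (circulant n J) D"
  unfolding positive_rank_def
proof
  fix q assume "q \<in> verts (circulant n J)"
  then have q: "q \<in> {1..n}"
    by simp
  \<comment> \<open>\<open>tents_move\<close> needs a centre in the lower half; \<open>b\<close> and
    its mirror image are \<open>q\<close> and \<open>n + 1 - q\<close> in some order.\<close>
  define b where "b = min q (n + 1 - q)"
  have b: "1 \<le> b" "2 * b \<le> n + 1"
    using q unfolding b_def min_def by auto
  obtain E where E: "equivalent_divisors (circulant n J) (D(q := D q - 1)) E"
    "\<And>x. x \<in> {1..n} \<Longrightarrow> E x = (D(q := D q - 1)) x - cyclic_tent n J a x
      - cyclic_tent n J (n + 1 - a) x + cyclic_tent n J b x + cyclic_tent n J (n + 1 - b) x"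
    using tents_move [OF assms(1,3-5) b, where D = "D(q := D q - 1)"] by metis
  have E_eq: "E x = cyclic_tent n J q x + cyclic_tent n J (n + 1 - q) x - of_bool (x = q)"
    if "x \<in> {1..n}" for x
    using E(2) [OF that] D [OF that] by (auto simp: b_def min_def)
  have "0 \<le> E x" if "x \<in> {1..n}" for x
  proof (cases "x = q")
    case True
    obtain j where "j \<in> J"
      using assms(2) by auto
    then show ?thesis
      using E_eq [OF that] True cyclic_tent_center_pos [OF assms(1), of j n q] bspec [OF assms(3), of j]
        cyclic_tent_nonneg [of n J "n + 1 - q" q] by auto
  next
    case False
    then show ?thesis
      using E_eq [OF that] cyclic_tent_nonneg [of n J q x] cyclic_tent_nonneg [of n J "n + 1 - q" x]
      by simp
  qed
  then have "effective (circulant n J) E"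
    by (simp add: effective_def)
  with E(1) show "\<exists>E. effective (circulant n J) E
      \<and> equivalent_divisors (circulant n J) (D(q := D q - 1)) E"
    by blast
qed

lemma positive_rank_if_pos:
  assumes "\<And>v. v \<in> verts G \<Longrightarrow> 0 < D v"
  shows "positive_rank G D"
  unfolding positive_rank_def effective_def
proof
  fix q
  have "\<forall>v\<in>verts G. 0 \<le> (D(q := D q - 1)) v"
    using assms by force
  then show "\<exists>E. (\<forall>v\<in>verts G. 0 \<le> E v) \<and> equivalent_divisors G (D(q := D q - 1)) E"
    using equivalent_divisors_refl by blast
qed

theorem theorem3p1:
  fixes n :: int and k :: nat and j :: "nat \<Rightarrow> int" and J :: "int set"
  assumes "k \<ge> 1"
    and "1 \<le> j 1"
    and "strict_mono_on {1..k} j"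
    and "J = j ` {1..k}"
    and "J \<subseteq> {1..n div 2}"
    and "Digraph_Component.connected (circulant n J)"
  shows "positive_rank (circulant n J) (circulant_divisor n k j)"
proof -
  let ?D = "circulant_divisor n k j"
  have le: "j i \<le> j k" if "i \<in> {1..k}" for i
    using strict_mono_on_leD [OF assms(3) that, of k] that by auto
  have inj: "inj_on j {1..k}"
    using assms(3) by (rule strict_mono_on_imp_inj_on)
  have "j k \<in> J"
    using assms(1) unfolding assms(4) by (intro imageI) simp
  then have "j k \<in> {1..n div 2}"
    using assms(5) by (rule subsetD [rotated])
  then have jk: "1 \<le> j k" "2 * j k \<le> n"
    by auto
  have J_pos: "1 \<le> i" "i \<le> j k" if "i \<in> J" for i
    using that assms(4,5) le by auto
  have tents_pos: "0 < (\<Sum>i = 1..k. max 0 (j i - d))" if "d < j k" for d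
    using that assms(1) by (intro sum_pos2 [of _ k]) auto
  show ?thesis
  \<comment> \<open>The tents are positive on \<open>{1..2 * j k - 1}\<close> and
    \<open>{n - 2 * j k + 2..n}\<close>; these cover \<open>{1..n}\<close> exactly when
    \<open>n \<le> 4 * j k - 2\<close>.\<close>
  proof (cases "n \<le> 4 * j k - 2")
    case True
    show ?thesis
    proof (rule positive_rank_if_pos)
      fix v assume "v \<in> verts (circulant n J)"
      then have "v \<in> {1..n}"
        by simp
      with True show "0 < ?D v"
        unfolding circulant_divisor_def by (auto simp del: One_nat_def intro!: tents_pos)
    qed
  next
    case False
    have tent: "cyclic_tent n J c x = (\<Sum>i = 1..k. max 0 (j i - \<bar>c - x\<bar>))"
      if "\<bar>x - c\<bar> + j k \<le> n" for c x
      using cyclic_tent_no_wrap [of J x c n] that J_pos assms(4) inj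
      by (force simp: sum.reindex)
    have zero: "(\<Sum>i = 1..k. max 0 (j i - d)) = 0" if "j k \<le> d" for d
      using that le by (intro sum.neutral) force
    show ?thesis
    proof (rule positive_rank_two_tents)
      show "finite J" "J \<noteq> {}"
        using assms(1,4) by auto
      \<comment> \<open>Here \<open>n \<ge> 4 * j k - 1\<close>, which exceeds
        \<open>2 * j k\<close> because \<open>j k \<ge> 1\<close>.\<close>
      show "\<forall>i\<in>J. 0 < i \<and> 2 * i < n"
        using J_pos False jk by fastforce
      show "1 \<le> j k" "2 * j k \<le> n + 1"
        using jk by auto
      fix x assume x: "x \<in> {1..n}"
      have left: "cyclic_tent n J (j k) x = (\<Sum>i = 1..k. max 0 (j i - \<bar>j k - x\<bar>))"
        using x jk by (intro tent) auto
      have "cyclic_tent n J (n + 1 - j k) x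
          = (\<Sum>i = 1..k. max 0 (j i - \<bar>n + 1 - j k - x\<bar>))"
        using x jk by (intro tent) auto
      also have "\<bar>n + 1 - j k - x\<bar> = \<bar>j k - (n - x + 1)\<bar>"
        by simp
      finally have right: "cyclic_tent n J (n + 1 - j k) x
          = (\<Sum>i = 1..k. max 0 (j i - \<bar>j k - (n - x + 1)\<bar>))" .
      \<comment> \<open>On the range of either formula the other tent vanishes, and in the gap both
        do. At \<open>n - 2 * j k + 1\<close> the second formula itself gives 0.\<close>
      show "?D x = cyclic_tent n J (j k) x + cyclic_tent n J (n + 1 - j k) x"
        unfolding left right circulant_divisor_def using x jk False
        by (auto simp: zero simp del: One_nat_def)
    qed
  qed
qed

end
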